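(* For each choice of sign $\varepsilon\in\{1,-1\}$ and all non-negative integers $u,v,w\le 15$, define the coefficients $h_u(n)$, $i_v(n)$, $j_w(n)$ (depending on $\varepsilon$) by the power series expansions $$\sum_{n=0}^{\infty}h_u(n)q^n=\left(q,q^6;q^7\right)_\infty\left(\varepsilon q^u,\varepsilon q^{21-u};q^{21}\right)_\infty^2,$$ $$\sum_{n=0}^{\infty}i_v(n)q^n=\left(q^2,q^5;q^7\right)_\infty\left(\varepsilon q^v,\varepsilon q^{21-v};q^{21}\right)_\infty^2,$$ $$\sum_{n=0}^{\infty}j_w(n)q^n=\left(q^3,q^4;q^7\right)_\infty\left(\varepsilon q^w,\varepsilon q^{21-w};q^{21}\right)_\infty^2.$$ Then, for each choice of $\varepsilon\in\{1,-1\}$ and all integers $n\ge 0$, $$h_3(7n+6)=h_4(7n+2)=h_{10}(7n+4)=0,$$ $$i_1(7n+2)=i_6(7n+3)=i_8(7n+6)=0,$$ $$j_2(7n+4)=j_5(7n+6)=j_9(7n+5)=0.$$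
   Context: For complex numbers $a,q$ with $|q|<1$, $(a;q)_\infty:=\prod_{k=0}^{\infty}(1-aq^k)$ and $(a_1,a_2,\dots,a_m;q)_\infty:=(a_1;q)_\infty(a_2;q)_\infty\cdots(a_m;q)_\infty$. The exponent $2$ on a product $(a_1,a_2;q)_\infty^2$ means the square of the whole product $(a_1,a_2;q)_\infty$. The infinite products are expanded as power series in $q$. *)

theory Defs
  imports "HOL-Analysis.Infinite_Products"
begin

text \<open>
  For \<open>norm q < 1\<close> the product converges in the sense of \<^const>\<open>convergent_prod\<close>; finitely
  many factors may vanish, in which case \<^const>\<open>prodinf\<close> is 0.
\<close>
definition qpoch_inf :: "complex \<Rightarrow> complex \<Rightarrow> complex" where
  "qpoch_inf a q = (\<Prod>k. 1 - a * q ^ k)"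

definition qpochs_inf :: "complex list \<Rightarrow> complex \<Rightarrow> complex" where
  "qpochs_inf as q = (\<Prod>a\<leftarrow>as. qpoch_inf a q)"

end

theory Submission
  imports
    Defs
    "HOL-Analysis.Infinite_Sum"
    "HOL-Analysis.Uniform_Limit"
    "HOL-Analysis.Complex_Transcendental"
begin

text \<open>
  After multiplication by \<open>(q\<^sup>7;q\<^sup>7)\<^sub>\<infinity> (q\<^sup>2\<^sup>1;q\<^sup>2\<^sup>1)\<^sub>\<infinity>\<^sup>2\<close>, each generating function becomes a product of
  three theta functions, and the Jacobi triple product expands it as a signed sum over
  \<open>(m, k, l) \<in> \<int>\<^sup>3\<close>: the sign is \<open>(-1)\<^sup>m (-\<epsilon>)\<^sup>k\<^sup>+\<^sup>l\<close> and the exponent of \<open>q\<close> is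
  \<open>E = r m + u (k + l) + 7 m(m-1)/2 + 21 (k(k-1)/2 + l(l-1)/2)\<close>, where \<open>r\<close> is \<open>1\<close>, \<open>2\<close>, \<open>3\<close>
  for \<open>h\<close>, \<open>i\<close>, \<open>j\<close>. The factor that was multiplied in is a nonvanishing function of \<open>q\<^sup>7\<close>,
  so it does not affect whether all coefficients in a residue class modulo \<open>7\<close> vanish
  (\<open>coeffs_residue_class_eq_0\<close>; the residue class is singled out by averaging over the
  seventh roots of unity).

  The quadratic part of \<open>2 E\<close> is \<open>7 (m\<^sup>2 + 3 k\<^sup>2 + 3 l\<^sup>2)\<close>, and the vector \<open>(1, \<sigma>, \<sigma>)\<close> with
  \<open>\<sigma> = \<plusminus>1\<close> has \<open>1 + 3 + 3 = 7\<close>. Hence there is an affine reflection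
  \<open>(m, k, l) \<mapsto> (m - t, k - \<sigma> t, l - \<sigma> t)\<close> that preserves \<open>E\<close>, and its \<open>t\<close> has
  denominator \<open>7\<close> only, provided that \<open>u \<equiv> 3 \<sigma> r\<close> modulo \<open>7\<close>. This congruence holds for all
  nine pairs \<open>(r, u)\<close> of the theorem, and it makes \<open>E\<close> congruent to
  \<open>r (m + 3 \<sigma> (k + l))\<close>. Therefore the points at which \<open>t\<close> is an integer form exactly one
  residue class of \<open>E\<close> modulo \<open>7\<close>, the class in the theorem. On that class \<open>t\<close> is odd, so
  the reflection changes the parity of \<open>m\<close> and keeps the parity of \<open>k + l\<close>: it flips the sign
  and leaves the exponent alone, for either \<open>\<epsilon>\<close>, and the terms cancel in pairs
  (\<open>theta_section_eq_0\<close>).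

  The triple product itself is obtained from its finite form
  (\<open>finite_jacobi_triple_product\<close>), which has a proof by induction, by dominated convergence.
\<close>

section \<open>Unordered sums\<close>

lemma has_sum_times:
  fixes f g :: "_ \<Rightarrow> complex"
  assumes f: "(f has_sum a) A" and g: "(g has_sum b) B"
  shows "((\<lambda>(x,y). f x * g y) has_sum (a * b)) (A \<times> B)"
proof -
  have af: "f abs_summable_on A" and ag: "g abs_summable_on B"
    using f g by (auto simp: summable_on_iff_abs_summable_on_complex [symmetric] summable_on_def)
  have "(\<lambda>x. norm (f x) * infsum (\<lambda>y. norm (g y)) B) summable_on A"
    by (rule summable_on_cmult_left [OF af])
  then have "(\<lambda>(x,y). f x * g y) abs_summable_on (A \<times> B)"
    unfolding abs_summable_on_Sigma_iff using ag af
    by (auto simp: norm_mult infsum_cmult_right' abs_mult infsum_nonneg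
             intro!: summable_on_cmult_right)
  then have "(\<lambda>(x,y). f x * g y) summable_on (A \<times> B)"
    by (rule abs_summable_summable)
  then obtain c where c: "((\<lambda>(x,y). f x * g y) has_sum c) (A \<times> B)"
    by (auto simp: summable_on_def)
  have "((\<lambda>x. f x * b) has_sum c) A"
    by (rule has_sum_Sigma' [OF c]) (simp add: has_sum_cmult_right g)
  moreover have "((\<lambda>x. f x * b) has_sum (a * b)) A"
    by (rule has_sum_cmult_left [OF f])
  ultimately have "c = a * b" by (rule has_sum_unique)
  with c show ?thesis by simp
qed

text \<open>
  The bound makes the partial sums over finite sets converge uniformly in \<open>n\<close>, so the limit in
  \<open>n\<close> and the limit over finite sets may be exchanged.
\<close>

lemma has_sum_dominated_convergence:
  fixes f :: "nat \<Rightarrow> 'a \<Rightarrow> complex"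
  assumes f: "\<And>n. (f n has_sum S n) A"
    and lim: "\<And>x. x \<in> A \<Longrightarrow> (\<lambda>n. f n x) \<longlonglongrightarrow> g x"
    and M: "M summable_on A" and le: "\<And>n x. x \<in> A \<Longrightarrow> norm (f n x) \<le> M x"
    and S: "S \<longlonglongrightarrow> L"
  shows "(g has_sum L) A"
proof -
  have u: "uniform_limit UNIV (\<lambda>X n. \<Sum>x\<in>X. f n x) S (finite_subsets_at_top A)"
    by (rule Weierstrass_m_test_general' [where M = M]) (use f M le in auto)
  have "norm (g x) \<le> M x" if "x \<in> A" for x
    by (rule LIMSEQ_le_const2 [OF tendsto_norm [OF lim [OF that]]]) (use le that in auto)
  then have "g abs_summable_on A"
    by (rule abs_summable_on_comparison_test' [OF M])
  then obtain T where T: "(g has_sum T) A"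
    using abs_summable_summable by (auto simp: summable_on_def)
  have "S \<longlonglongrightarrow> T"
  proof (rule swap_uniform_limit' [OF _ _ u])
    show "\<forall>\<^sub>F X in finite_subsets_at_top A.
        (\<lambda>n. \<Sum>x\<in>X. f n x) \<longlonglongrightarrow> (\<Sum>x\<in>X. g x)"
      by (rule eventually_finite_subsets_at_top_weakI) (auto intro!: tendsto_sum lim)
    show "(sum g \<longlongrightarrow> T) (finite_subsets_at_top A)"
      using T by (simp add: has_sum_def)
  qed auto
  then have "T = L" using S LIMSEQ_unique by blast
  with T show ?thesis by simp
qed

text \<open>
  Reindexing by the involution \<open>\<rho>\<close> negates the sum. A fixed point of \<open>\<rho>\<close> causes no trouble,
  since \<open>f\<close> vanishes there.
\<close>

lemma has_sum_0_sign_reversing: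
  fixes f :: "'a \<Rightarrow> complex"
  assumes "f summable_on B"
    and "\<And>x. x \<in> B \<Longrightarrow> \<rho> x \<in> B" "\<And>x. x \<in> B \<Longrightarrow> \<rho> (\<rho> x) = x"
    and "\<And>x. x \<in> B \<Longrightarrow> f (\<rho> x) = - f x"
  shows "(f has_sum 0) B"
proof -
  obtain S where S: "(f has_sum S) B" using assms(1) by (auto simp: summable_on_def)
  have "((\<lambda>x. - f x) has_sum S) B"
    by (subst has_sum_reindex_bij_witness [where i = \<rho> and j = \<rho> and T = B and h = f and s' = S])
       (use assms S in auto)
  moreover have "((\<lambda>x. - f x) has_sum - S) B"
    using S by (rule has_sum_uminusI)
  ultimately have "S = - S" by (rule has_sum_unique)
  then have "S = 0" by (simp add: eq_neg_iff_add_eq_0 flip: mult_2)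
  with S show ?thesis by simp
qed

lemma has_sum_finite_sum:
  fixes f :: "'a \<Rightarrow> 'b \<Rightarrow> complex"
  assumes "finite J" "\<And>j. j \<in> J \<Longrightarrow> (f j has_sum S j) A"
  shows "((\<lambda>x. \<Sum>j\<in>J. f j x) has_sum (\<Sum>j\<in>J. S j)) A"
  using assms by (induction J rule: finite_induct) (auto intro: has_sum_add)

section \<open>The Jacobi triple product\<close>

text \<open>
  The sum over all integers \<open>k\<close> is the theta function of base \<open>p\<close> that vanishes exactly at
  the integer powers \<open>z = p\<^sup>n\<close>. The division by \<open>2\<close> is exact.
\<close>

definition theta_term :: "complex \<Rightarrow> complex \<Rightarrow> int \<Rightarrow> complex" where
  "theta_term z p k = (-z) powi k * p powi (k * (k - 1) div 2)"

definition qfact :: "complex \<Rightarrow> nat \<Rightarrow> complex" where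
  "qfact p n = (\<Prod>i<n. 1 - p ^ Suc i)"

text \<open>
  Setting \<open>1 / (p;p)\<^sub>k\<close> to \<open>0\<close> for negative \<open>k\<close> lets the finite triple product be written as a
  sum over all integers, so that index shifts produce no boundary terms, and it keeps the
  recurrence \<open>inv_qfact_step\<close> valid for every integer.
\<close>

definition inv_qfact :: "complex \<Rightarrow> int \<Rightarrow> complex" where
  "inv_qfact p k = (if k < 0 then 0 else inverse (qfact p (nat k)))"

lemma one_minus_power_neq_0:
  fixes p :: complex assumes "norm p < 1" shows "1 - p ^ Suc i \<noteq> 0"
proof
  assume "1 - p ^ Suc i = 0"
  then have "p ^ Suc i = 1" by simp
  then have "norm p ^ Suc i = 1" by (metis norm_one norm_power)
  moreover have "norm p ^ Suc i < 1" using assms by (simp add: power_less_one_iff del: power_Suc)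
  ultimately show False by simp
qed

lemma qfact_neq_0: "norm p < 1 \<Longrightarrow> qfact p n \<noteq> 0"
  using one_minus_power_neq_0 by (simp add: qfact_def del: power_Suc)

lemma inv_qfact_step:
  assumes "norm p < 1"
  shows "inv_qfact p (k - 1) = (1 - p powi k) * inv_qfact p k"
proof (cases "k > 0")
  case True
  then obtain n where n: "k = int (Suc n)" by (metis gr0_conv_Suc pos_int_cases)
  have "qfact p (Suc n) = qfact p n * (1 - p ^ Suc n)" by (simp add: qfact_def)
  then show ?thesis
    using one_minus_power_neq_0 [OF assms, of n] qfact_neq_0 [OF assms, of n]
    unfolding n inv_qfact_def nat_int power_int_of_nat by (simp del: power_Suc)
next
  case False
  then show ?thesis by (cases "k = 0") (auto simp: inv_qfact_def)
qed

lemma theta_term_Suc: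
  assumes "p \<noteq> 0" "z \<noteq> 0"
  shows "theta_term z p (k + 1) = - z * p powi k * theta_term z p k"
proof -
  have "(k + 1) * (k + 1 - 1) div 2 = k + k * (k - 1) div 2"
  proof -
    have "(k + 1) * (k + 1 - 1) = k * 2 + k * (k - 1)" by (simp add: algebra_simps)
    then show ?thesis by simp
  qed
  then show ?thesis using assms by (simp add: theta_term_def power_int_add)
qed

text \<open>
  The coefficient of \<open>theta_term z p k\<close> is the Gaussian binomial coefficient of \<open>2 N\<close> over
  \<open>N + k\<close>. The two factors that \<open>Suc N\<close> adds have the product
  \<open>(1 + p\<^bsup>2N+1\<^esup>) - z p\<^sup>N - p\<^bsup>N+1\<^esup>/z\<close>; its last two terms shift the summation index by one in
  either direction, and the coefficients satisfy the resulting three-term recurrence.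
\<close>

lemma finite_jacobi_triple_product:
  assumes p: "norm p < 1" "p \<noteq> 0" and z: "z \<noteq> 0"
  shows "((\<lambda>k. qfact p (2 * N) * inv_qfact p (int N + k) * inv_qfact p (int N - k) * theta_term z p k)
    has_sum (\<Prod>j<N. (1 - z * p ^ j) * (1 - p ^ Suc j / z))) UNIV"
proof (induction N)
  case 0
  show ?case
    by (rule has_sum_finite_neutralI [where B = "{0}"])
       (auto simp: inv_qfact_def qfact_def theta_term_def)
next
  case (Suc N)
  define P where "P = (\<Prod>j<N. (1 - z * p ^ j) * (1 - p ^ Suc j / z))"
  define c where "c = (\<lambda>N k. qfact p (2 * N) * inv_qfact p (int N + k) * inv_qfact p (int N - k) * theta_term z p k)"
  have 0: "(c N has_sum P) UNIV" unfolding c_def P_def by (rule Suc.IH)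
  have 1: "((\<lambda>k. c N (k + d)) has_sum P) UNIV" for d
    by (subst has_sum_reindex_bij_betw [of "\<lambda>k. k + d" UNIV UNIV]) 
       (use 0 in \<open>auto intro!: bij_betwI [where g = "\<lambda>k. k - d"]\<close>)
  have "((\<lambda>k. (1 + p ^ (2 * N + 1)) * c N k + ((- z * p ^ N) * c N (k + (-1)) + (- (p ^ Suc N / z)) * c N (k + 1)))
     has_sum ((1 + p ^ (2 * N + 1)) * P + ((- z * p ^ N) * P + (- (p ^ Suc N / z)) * P))) UNIV"
    by (intro has_sum_add has_sum_cmult_right 0 1)
  also have "(1 + p ^ (2 * N + 1)) * P + ((- z * p ^ N) * P + (- (p ^ Suc N / z)) * P) 
     = P * ((1 - z * p ^ N) * (1 - p ^ Suc N / z))"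
    using z by (simp add: field_simps power_add power_mult power2_eq_square flip: power_mult_distrib)
  also have "\<dots> = (\<Prod>j<Suc N. (1 - z * p ^ j) * (1 - p ^ Suc j / z))" by (simp add: P_def)
  also have "(\<lambda>k. (1 + p ^ (2 * N + 1)) * c N k + ((- z * p ^ N) * c N (k + (-1)) + (- (p ^ Suc N / z)) * c N (k + 1))) = c (Suc N)"
  proof
    fix k
    \<comment> \<open>With \<open>X = p\<^bsup>N+1+k\<^esup>\<close> and \<open>Y = p\<^bsup>N+1-k\<^esup>\<close>, all terms are multiples of
      \<open>Q * I * T\<close>, and the recurrence becomes a rational identity in \<open>X\<close>, \<open>Y\<close> and \<open>p\<close>.\<close>
    define X where "X = p powi (int N + 1 + k)"
    define Y where "Y = p powi (int N + 1 - k)"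
    define I where "I = inv_qfact p (int N + 1 + k) * inv_qfact p (int N + 1 - k)"
    define T where "T = theta_term z p k"
    define Q where "Q = qfact p (2 * N)"
    define R where "R = p powi k"
    have XR: "X = p * p ^ N * R" and YR: "Y * R = p * p ^ N" 
      using p by (simp_all add: X_def Y_def R_def power_int_add power_int_diff)
    have "X * Y = p * p ^ N * (Y * R)" by (simp add: XR)
    then have XY: "X * Y = p ^ (2 * N + 2)"
      unfolding YR by (simp add: mult_2 power_add)
    have a1: "inv_qfact p (int N + k) = (1 - X) * inv_qfact p (int N + 1 + k)"
      and b1: "inv_qfact p (int N - k) = (1 - Y) * inv_qfact p (int N + 1 - k)"
      using inv_qfact_step [OF p(1), of "int N + 1 + k"] inv_qfact_step [OF p(1), of "int N + 1 - k"]
      by (simp_all add: X_def Y_def algebra_simps)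
    have a2: "inv_qfact p (int N + k - 1) = (1 - X / p) * inv_qfact p (int N + k)"
      and b2: "inv_qfact p (int N - k - 1) = (1 - Y / p) * inv_qfact p (int N - k)"
      using inv_qfact_step [OF p(1), of "int N + k"] inv_qfact_step [OF p(1), of "int N - k"] p
      by (simp_all add: X_def Y_def power_int_add power_int_diff algebra_simps)
    have e0: "c N k = Q * I * T * ((1 - X) * (1 - Y))"
      by (simp add: c_def a1 b1 Q_def I_def T_def)
    have T1: "z * p ^ N * theta_term z p (k - 1) = - Y * T"
    proof -
      have "T = - z * (R / p) * theta_term z p (k - 1)"
        using theta_term_Suc [OF p(2) z, of "k - 1"] p by (simp add: T_def R_def power_int_diff)
      moreover have "p ^ N = Y * R / p" using YR p by simp
      ultimately show ?thesis by simp
    qed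
    have T2: "p ^ Suc N / z * theta_term z p (k + 1) = - X * T"
      using theta_term_Suc [OF p(2) z, of k] z by (simp add: T_def XR R_def)
    have "(- z * p ^ N) * c N (k + (-1)) = 
       - Q * (inv_qfact p (int N + k - 1) * inv_qfact p (int N + 1 - k)) * (z * p ^ N * theta_term z p (k - 1))"
      by (simp add: c_def Q_def algebra_simps)
    then have e1: "(- z * p ^ N) * c N (k + (-1)) = Q * I * T * (Y * (1 - X) * (1 - X / p))"
      unfolding T1 a2 a1 by (simp add: I_def)
    have "(- (p ^ Suc N / z)) * c N (k + 1) = 
       - Q * (inv_qfact p (int N - k - 1) * inv_qfact p (int N + 1 + k)) * (p ^ Suc N / z * theta_term z p (k + 1))"
      by (simp add: c_def Q_def algebra_simps)
    then have e2: "(- (p ^ Suc N / z)) * c N (k + 1) = Q * I * T * (X * (1 - Y) * (1 - Y / p))"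
      unfolding T2 b2 b1 by (simp add: I_def)
    have p1: "p ^ (2 * N + 1) = X * Y / p" using XY p by simp
    have "qfact p (2 * Suc N) = Q * (1 - p ^ (2 * N + 1)) * (1 - p ^ (2 * N + 2))"
      by (simp add: Q_def qfact_def)
    then have "qfact p (2 * Suc N) = Q * (1 - X * Y / p) * (1 - X * Y)"
      unfolding p1 XY by simp
    moreover have "c (Suc N) k = qfact p (2 * Suc N) * I * T"
      by (simp add: c_def I_def T_def add_ac)
    ultimately have e3: "c (Suc N) k = Q * I * T * ((1 - X * Y / p) * (1 - X * Y))"
      by (simp only: mult_ac)
    have lin: "x * (w * a) + (w * b + w * c) = w * (x * a + (b + c))" for x w a b c :: complex
      by (simp add: algebra_simps)
    have "(1 + X * Y / p) * ((1 - X) * (1 - Y)) + (Y * (1 - X) * (1 - X / p) + X * (1 - Y) * (1 - Y / p))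
        = (1 - X * Y / p) * (1 - X * Y)"
      using p by (simp add: field_simps)
    then show "(1 + p ^ (2 * N + 1)) * c N k + ((- z * p ^ N) * c N (k + (-1)) + (- (p ^ Suc N / z)) * c N (k + 1)) = c (Suc N) k"
      unfolding e0 e1 e2 e3 p1 lin by (rule arg_cong)
  qed
  finally show ?case unfolding c_def .
qed

lemma tendsto_qpoch_inf:
  assumes "norm p < 1"
  shows "(\<lambda>n. \<Prod>j<n. 1 - a * p ^ j) \<longlonglongrightarrow> qpoch_inf a p"
    and "(\<And>j. a * p ^ j \<noteq> 1) \<Longrightarrow> qpoch_inf a p \<noteq> 0"
proof -
  have "summable (\<lambda>j. norm ((1 - a * p ^ j) - 1))"
    using assms by (auto simp: norm_mult norm_power intro!: summable_mult summable_geometric)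
  then have conv: "convergent_prod (\<lambda>j. 1 - a * p ^ j)"
    by (intro abs_convergent_prod_imp_convergent_prod summable_imp_abs_convergent_prod)
  then have "(\<lambda>n. \<Prod>j<Suc n. 1 - a * p ^ j) \<longlonglongrightarrow> qpoch_inf a p"
    using convergent_prod_LIMSEQ unfolding qpoch_inf_def lessThan_Suc_atMost by blast
  then show "(\<lambda>n. \<Prod>j<n. 1 - a * p ^ j) \<longlonglongrightarrow> qpoch_inf a p"
    by (rule LIMSEQ_imp_Suc)
  show "qpoch_inf a p \<noteq> 0" if "\<And>j. a * p ^ j \<noteq> 1"
    unfolding qpoch_inf_def using conv that by (intro prodinf_nonzero) auto
qed

lemma qpoch_inf_self_neq_0: "norm p < 1 \<Longrightarrow> qpoch_inf p p \<noteq> 0"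
  using tendsto_qpoch_inf(2) [of p p] one_minus_power_neq_0 [of p] by auto

lemma tendsto_qfact: "norm p < 1 \<Longrightarrow> qfact p \<longlonglongrightarrow> qpoch_inf p p"
  using tendsto_qpoch_inf(1) [of p p] by (simp add: qfact_def [abs_def])

lemma tendsto_inv_qfact:
  assumes "norm p < 1"
  shows "((\<lambda>k. inv_qfact p k) \<longlongrightarrow> inverse (qpoch_inf p p)) at_top"
proof (rule Lim_transform_eventually)
  have "filterlim nat sequentially at_top" by (rule filterlim_nat_sequentially)
  then show "((\<lambda>k. inverse (qfact p (nat k))) \<longlongrightarrow> inverse (qpoch_inf p p)) at_top"
    by (intro tendsto_inverse qpoch_inf_self_neq_0 assms
              filterlim_compose [OF tendsto_qfact [OF assms]])
  show "\<forall>\<^sub>F k in at_top. inverse (qfact p (nat k)) = inv_qfact p k"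
    using eventually_ge_at_top [of 0] by eventually_elim (simp add: inv_qfact_def)
qed

text \<open>
  Reduces the summability over negative indices to that over natural ones.
\<close>

lemma theta_term_uminus:
  assumes "p \<noteq> 0" "z \<noteq> 0"
  shows "theta_term z p (- k) = theta_term (p / z) p k"
proof -
  have "- k * (- k - 1) = k * 2 + k * (k - 1)" by (simp add: algebra_simps)
  then have "- k * (- k - 1) div 2 = k + k * (k - 1) div 2" by simp
  then have "theta_term z p (- k) = (- z) powi (- k) * (p powi k * p powi (k * (k - 1) div 2))"
    using assms by (simp only: theta_term_def) (simp add: power_int_add)
  moreover have "(- z) powi (- k) * p powi k = (- (p / z)) powi k"
  proof -
    have "- (p / z) = inverse (- z) * p" by (simp add: divide_inverse)
    then show ?thesis
      by (simp only: power_int_mult_distrib power_int_inverse power_int_minus)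
  qed
  ultimately show ?thesis by (simp only: theta_term_def mult.assoc [symmetric])
qed

lemma filterlim_at_top_int_add: "filterlim (\<lambda>n. int n + k) at_top sequentially"
  unfolding filterlim_at_top eventually_sequentially
proof
  fix Z show "\<exists>N. \<forall>n\<ge>N. Z \<le> int n + k" by (rule exI [of _ "nat (Z - k)"]) auto
qed

lemma theta_term_summable:
  assumes p: "norm p < 1" "p \<noteq> 0" and z: "z \<noteq> 0"
  shows "theta_term z p abs_summable_on UNIV"
proof -
  have nat: "(\<lambda>k. norm (theta_term w p k)) summable_on range int" if w: "w \<noteq> 0" for w
  proof -
    have "(\<lambda>n. norm w * norm p ^ n) \<longlonglongrightarrow> norm w * 0"
      using p by (intro tendsto_intros LIMSEQ_power_zero) auto
    then have "\<forall>\<^sub>F n in sequentially. norm w * norm p ^ n < 1 / 2"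
      by (rule order_tendstoD) auto
    then obtain N where N: "\<And>n. n \<ge> N \<Longrightarrow> norm w * norm p ^ n < 1 / 2"
      by (auto simp: eventually_at_top_linorder)
    have "summable (\<lambda>n. norm (theta_term w p (int n)))"
    proof (rule summable_ratio_test [where c = "1 / 2" and N = N])
      fix n assume "n \<ge> N"
      have "theta_term w p (int (Suc n)) = - w * p ^ n * theta_term w p (int n)"
        using theta_term_Suc [OF p(2) w, of "int n"] by (simp add: add.commute)
      then have "norm (theta_term w p (int (Suc n))) = (norm w * norm p ^ n) * norm (theta_term w p (int n))"
        by (simp add: norm_mult norm_power)
      also have "\<dots> \<le> 1 / 2 * norm (theta_term w p (int n))"
        using N [OF \<open>n \<ge> N\<close>] by (intro mult_right_mono) auto
      finally show "norm (norm (theta_term w p (int (Suc n)))) \<le> 1 / 2 * norm (norm (theta_term w p (int n)))"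
        by simp
    qed simp
    then have "(\<lambda>n. norm (theta_term w p (int n))) summable_on UNIV"
      by (subst summable_on_UNIV_nonneg_real_iff) auto
    then show ?thesis by (subst summable_on_reindex) (auto simp: o_def)
  qed
  have "(\<lambda>k. norm (theta_term z p k)) summable_on uminus ` range int"
    using nat [of "p / z"] p z by (subst summable_on_reindex) (auto simp: o_def theta_term_uminus)
  then have neg: "(\<lambda>k. norm (theta_term z p k)) summable_on (uminus ` range int - {0})"
    by (rule summable_on_subset_banach) auto
  have UNIV: "UNIV = range int \<union> (uminus ` range int - {0})"
    by (auto simp: image_iff) (metis int_cases2)
  show ?thesis
    by (subst UNIV, intro summable_on_Un_disjoint neg nat [OF z]) auto
qed

theorem jacobi_triple_product:
  assumes p: "norm p < 1" "p \<noteq> 0" and z: "z \<noteq> 0"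
  shows "(theta_term z p has_sum qpoch_inf z p * qpoch_inf (p / z) p * qpoch_inf p p) UNIV"
proof -
  define E where "E = qpoch_inf p p"
  have "E \<noteq> 0" using p by (simp add: E_def qpoch_inf_self_neq_0)
  then have eq: "E * (E * inverse E * inverse E * t) = t" for t by simp
  have "Bseq (qfact p)" "Bseq (\<lambda>n. inverse (qfact p n))"
    using p by (auto intro!: convergent_imp_Bseq convergentI tendsto_qfact tendsto_inverse qpoch_inf_self_neq_0)
  then obtain B C where B: "\<And>n. norm (qfact p n) \<le> B" and C: "\<And>n. norm (inverse (qfact p n)) \<le> C"
    by (auto simp: Bseq_def)
  have "0 \<le> norm (qfact p 0)" "0 \<le> norm (inverse (qfact p 0))" by simp_all
  then have B0: "B \<ge> 0" and C0: "C \<ge> 0" using B [of 0] C [of 0] by linarith+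
  have C': "norm (inv_qfact p k) \<le> C" for k using C C0 by (simp add: inv_qfact_def)
  have lim: "(\<lambda>N. inv_qfact p (int N + k)) \<longlonglongrightarrow> inverse E" for k
    unfolding E_def
    by (rule filterlim_compose [OF tendsto_inv_qfact [OF p(1)]])
       (rule filterlim_at_top_int_add)
  \<comment> \<open>In the limit \<open>N \<rightarrow> \<infinity>\<close>, \<open>(p;p)\<^bsub>2N\<^esub> / ((p;p)\<^bsub>N+k\<^esub> (p;p)\<^bsub>N-k\<^esub>)\<close> tends to \<open>E / E\<^sup>2\<close>,
    while staying bounded by \<open>B * C * C\<close>.\<close>
  have "((\<lambda>k. E * inverse E * inverse E * theta_term z p k) has_sum qpoch_inf z p * qpoch_inf (p / z) p) UNIV"
  proof (rule has_sum_dominated_convergence [OF finite_jacobi_triple_product [OF p z]])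
    show "(\<lambda>N. qfact p (2 * N) * inv_qfact p (int N + k) * inv_qfact p (int N - k) * theta_term z p k)
      \<longlonglongrightarrow> E * inverse E * inverse E * theta_term z p k" for k
      using lim [of "- k"] lim [of k]
        LIMSEQ_subseq_LIMSEQ [OF tendsto_qfact [OF p(1)], of "\<lambda>N. 2 * N"]
      by (intro tendsto_mult tendsto_const) (auto simp: E_def o_def strict_mono_def)
    show "(\<lambda>k. B * C * C * norm (theta_term z p k)) summable_on UNIV"
      by (intro summable_on_cmult_right theta_term_summable p z)
    show "norm (qfact p (2 * N) * inv_qfact p (int N + k) * inv_qfact p (int N - k) * theta_term z p k)
      \<le> B * C * C * norm (theta_term z p k)" for N k
      unfolding norm_mult by (intro mult_mono B C' B0 C0 mult_nonneg_nonneg norm_ge_zero order_refl)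
    have "(\<lambda>N. (\<Prod>j<N. 1 - z * p ^ j) * (\<Prod>j<N. 1 - (p / z) * p ^ j))
      \<longlonglongrightarrow> qpoch_inf z p * qpoch_inf (p / z) p"
      by (intro tendsto_mult tendsto_qpoch_inf p)
    then show "(\<lambda>N. \<Prod>j<N. (1 - z * p ^ j) * (1 - p ^ Suc j / z))
      \<longlonglongrightarrow> qpoch_inf z p * qpoch_inf (p / z) p"
      by (simp add: prod.distrib)
  qed
  from has_sum_cmult_right [OF this, of E] show ?thesis
    unfolding eq by (simp only: E_def mult_ac)
qed

section \<open>Power series restricted to a residue class\<close>

lemma cis_root_of_unity_power: "m > 0 \<Longrightarrow> cis (2 * pi / real m) ^ m = 1"
  using Complex.DeMoivre [of "2 * pi / real m" m] by simp

lemma sum_root_of_unity_powi: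
  assumes "m > 0" 
  shows "(\<Sum>j<m. (cis (2 * pi / m) ^ j) powi n) = (if int m dvd n then of_nat m else 0)"
proof -
  define r where "r = cis (2 * pi / m) powi n"
  have r: "(cis (2 * pi / m) ^ j) powi n = r ^ j" for j
    by (simp add: r_def power_int_power power_int_power' mult.commute)
  have "r ^ m = (cis (2 * pi / m) ^ m) powi n" by (rule r [symmetric])
  then have rm: "r ^ m = 1" using assms by (simp add: cis_root_of_unity_power)
  have "r = 1 \<longleftrightarrow> int m dvd n"
  proof -
    have "r = cis (of_int n * (2 * pi / m))"
      unfolding r_def by (rule cis_power_int)
    then have "r = exp (\<i> * complex_of_real (2 * pi / m * n))"
      by (simp add: cis_conv_exp mult_ac)
    then have "r = 1 \<longleftrightarrow> (\<exists>k::int. 2 * pi / m * n = 2 * pi * k)"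
      by (simp add: exp_eq_1 mult_ac)
    also have "\<dots> \<longleftrightarrow> (\<exists>k::int. real_of_int n = real_of_int (m * k))"
      using assms by (intro ex_cong1) (auto simp: field_simps)
    also have "\<dots> \<longleftrightarrow> int m dvd n" unfolding of_int_eq_iff by (auto simp: dvd_def)
    finally show ?thesis .
  qed
  then show ?thesis using rm by (simp add: r sum_gp_strict)
qed

text \<open>
  Averaging over the substitutions \<open>q \<mapsto> \<omega>\<^sup>j q\<close>, with \<open>\<omega>\<close> a primitive \<open>m\<close>-th root of unity,
  retains exactly the terms whose exponent lies in a given residue class modulo \<open>m\<close>.
\<close>

lemma has_sum_residue_class:
  fixes s :: "'a \<Rightarrow> complex" and e :: "'a \<Rightarrow> int"
  assumes m: "m > 0" and q: "q \<noteq> 0"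
    and F: "\<And>j. j < m \<Longrightarrow> ((\<lambda>x. s x * (cis (2 * pi / m) ^ j * q) powi e x) has_sum F j) A"
  shows "((\<lambda>x. s x * q powi e x) has_sum
    (\<Sum>j<m. (cis (2 * pi / m) ^ j) powi (- c) * F j) / of_nat m) {x \<in> A. int m dvd e x - c}"
proof -
  have "((\<lambda>x. (\<Sum>j<m. (cis (2 * pi / m) ^ j) powi (- c) * (s x * (cis (2 * pi / m) ^ j * q) powi e x)) * (1 / of_nat m))
     has_sum (\<Sum>j<m. (cis (2 * pi / m) ^ j) powi (- c) * F j) * (1 / of_nat m)) A"
    by (intro has_sum_cmult_left has_sum_finite_sum has_sum_cmult_right F) auto
  also have "(\<lambda>x. (\<Sum>j<m. (cis (2 * pi / m) ^ j) powi (- c) * (s x * (cis (2 * pi / m) ^ j * q) powi e x)) * (1 / of_nat m))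
     = (\<lambda>x. if int m dvd e x - c then s x * q powi e x else 0)"
  proof
    fix x
    have "(\<Sum>j<m. (cis (2 * pi / m) ^ j) powi (- c) * (s x * (cis (2 * pi / m) ^ j * q) powi e x))
       = (\<Sum>j<m. (cis (2 * pi / m) ^ j) powi (e x - c)) * (s x * q powi e x)"
      unfolding sum_distrib_right
    proof (intro sum.cong refl)
      fix j
      have "(cis (2 * pi / m) ^ j) powi (e x - c) = (cis (2 * pi / m) ^ j) powi (- c) * (cis (2 * pi / m) ^ j) powi e x"
        using power_int_add [of "cis (2 * pi / m) ^ j" "- c" "e x"] by simp
      then show "(cis (2 * pi / m) ^ j) powi (- c) * (s x * (cis (2 * pi / m) ^ j * q) powi e x)
          = (cis (2 * pi / m) ^ j) powi (e x - c) * (s x * q powi e x)"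
        by (simp only: power_int_mult_distrib mult_ac)
    qed
    then show "(\<Sum>j<m. (cis (2 * pi / m) ^ j) powi (- c) * (s x * (cis (2 * pi / m) ^ j * q) powi e x)) * (1 / of_nat m)
     = (if int m dvd e x - c then s x * q powi e x else 0)"
      using m by (simp add: sum_root_of_unity_powi)
  qed
  finally have "((\<lambda>x. if int m dvd e x - c then s x * q powi e x else 0) has_sum
     (\<Sum>j<m. (cis (2 * pi / m) ^ j) powi (- c) * F j) * (1 / of_nat m)) A" .
  then show ?thesis
    by (subst has_sum_cong_neutral [where T = A and g = "\<lambda>x. if int m dvd e x - c then s x * q powi e x else 0"]) auto
qed

text \<open>
  The constant coefficient is the limit at \<open>0\<close>; dividing by \<open>q\<close> then shifts the coefficients
  down. The point \<open>q = 0\<close> is excluded because expansions with integer exponents are available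
  only away from it.
\<close>

lemma powser_eq_0_imp_coeffs_0:
  fixes a :: "nat \<Rightarrow> complex"
  assumes "\<And>q. q \<noteq> 0 \<Longrightarrow> norm q < 1 \<Longrightarrow> (\<lambda>n. a n * q ^ n) sums 0"
  shows "a n = 0"
  using assms
proof (induction n arbitrary: a)
  case 0
  have "((\<lambda>_. 0) \<longlongrightarrow> a 0) (at (0 :: complex))"
    by (rule powser_limit_0_strong [of 1]) (auto intro: 0)
  then show ?case by (simp add: tendsto_const_iff)
next
  case (Suc n)
  have "((\<lambda>_. 0) \<longlongrightarrow> a 0) (at (0 :: complex))"
    by (rule powser_limit_0_strong [of 1]) (auto intro: Suc.prems)
  then have a0: "a 0 = 0" by (simp add: tendsto_const_iff)
  show ?case
  proof (rule Suc.IH [of "\<lambda>n. a (Suc n)"])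
    fix q :: complex assume q: "q \<noteq> 0" "norm q < 1"
    have "(\<lambda>n. a (Suc n) * q ^ Suc n) sums 0"
      using Suc.prems [OF q] a0 by (subst sums_Suc_iff) simp
    from sums_divide [OF this, of q] show "(\<lambda>n. a (Suc n) * q ^ n) sums 0"
      using q by simp
  qed
qed

lemma has_sum_powser:
  fixes a :: "nat \<Rightarrow> complex"
  assumes H: "\<And>q. norm q < 1 \<Longrightarrow> (\<lambda>n. a n * q ^ n) sums H q" and q: "norm q < 1"
  shows "((\<lambda>n. a n * q ^ n) has_sum H q) UNIV"
proof -
  obtain t where t: "norm q < t" "t < 1" using q dense by blast
  then have t': "norm (complex_of_real t) = t" using norm_ge_zero [of q] by (simp del: norm_ge_zero)
  have "summable (\<lambda>n. a n * complex_of_real t ^ n)"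
    using H [of "of_real t"] t t' by (simp add: sums_summable)
  then have "summable (\<lambda>n. norm (a n * q ^ n))"
    by (rule powser_insidea) (use t t' in simp)
  then show ?thesis by (rule norm_summable_imp_has_sum) (rule H [OF q])
qed

text \<open>
  The substitutions \<open>q \<mapsto> \<omega>\<^sup>j q\<close> fix \<open>P (q ^ m)\<close>, so restricting the expansion of
  \<open>P (q ^ m) * H q\<close> to a residue class gives \<open>P (q ^ m)\<close> times the restriction of \<open>H\<close>. As
  \<open>P (q ^ m)\<close> is nonzero, the restriction of \<open>H\<close> vanishes as soon as the other one does.
\<close>

lemma coeffs_residue_class_eq_0:
  fixes a :: "nat \<Rightarrow> complex" and s :: "'a \<Rightarrow> complex" and e :: "'a \<Rightarrow> int"
  assumes m: "m > 0"
    and H: "\<And>q. norm q < 1 \<Longrightarrow> (\<lambda>n. a n * q ^ n) sums H q"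
    and F: "\<And>q. q \<noteq> 0 \<Longrightarrow> norm q < 1 \<Longrightarrow> ((\<lambda>x. s x * q powi e x) has_sum P (q ^ m) * H q) A"
    and P: "\<And>y. norm y < 1 \<Longrightarrow> P y \<noteq> 0"
    and zero: "\<And>q. q \<noteq> 0 \<Longrightarrow> norm q < 1 \<Longrightarrow> ((\<lambda>x. s x * q powi e x) has_sum 0) {x \<in> A. int m dvd e x - c}"
    and n: "int m dvd int n - c"
  shows "a n = 0"
proof -
  have "(if int m dvd int n - c then a n else 0) = 0"
  proof (rule powser_eq_0_imp_coeffs_0)
    fix q :: complex assume q: "q \<noteq> 0" "norm q < 1"
    define w where "w = cis (2 * pi / m)"
    define S where "S = (\<Sum>j<m. (w ^ j) powi (- c) * H (w ^ j * q)) / of_nat m"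
    have wm: "w ^ m = 1" using m by (simp add: w_def cis_root_of_unity_power)
    have wq: "w ^ j * q \<noteq> 0" "norm (w ^ j * q) < 1" "(w ^ j * q) ^ m = q ^ m" for j
    proof -
      show "w ^ j * q \<noteq> 0" "norm (w ^ j * q) < 1" 
        using q by (auto simp: w_def norm_mult norm_power)
      have "(w ^ j) ^ m = (w ^ m) ^ j" by (simp add: mult.commute flip: power_mult)
      then show "(w ^ j * q) ^ m = q ^ m" by (simp add: power_mult_distrib wm)
    qed
    have "((\<lambda>n. a n * q powi int n) has_sum S) {n \<in> UNIV. int m dvd int n - c}"
      unfolding S_def w_def
    proof (rule has_sum_residue_class [OF m q(1)])
      fix j
      show "((\<lambda>n. a n * (cis (2 * pi / m) ^ j * q) powi int n) has_sum H (cis (2 * pi / m) ^ j * q)) UNIV"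
        using has_sum_powser [OF H wq(2)] unfolding w_def power_int_of_nat .
    qed
    moreover have "((\<lambda>x. s x * q powi e x) has_sum
       (\<Sum>j<m. (w ^ j) powi (- c) * (P (q ^ m) * H (w ^ j * q))) / of_nat m) {x \<in> A. int m dvd e x - c}"
      unfolding w_def
    proof (rule has_sum_residue_class [OF m q(1)])
      fix j
      show "((\<lambda>x. s x * (cis (2 * pi / m) ^ j * q) powi e x) has_sum
          P (q ^ m) * H (cis (2 * pi / m) ^ j * q)) A"
        using F [OF wq(1,2)] unfolding wq(3) unfolding w_def .
    qed
    then have "(\<Sum>j<m. (w ^ j) powi (- c) * (P (q ^ m) * H (w ^ j * q))) / of_nat m = 0"
      using zero [OF q] has_sum_unique by blast
    then have "P (q ^ m) * S = 0"
      by (simp add: S_def sum_distrib_left mult.left_commute)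
    moreover have "norm (q ^ m) < 1" using q m by (simp add: norm_power power_less_one_iff)
    then have "P (q ^ m) \<noteq> 0" by (rule P)
    ultimately have "((\<lambda>n. a n * q powi int n) has_sum 0) {n \<in> UNIV. int m dvd int n - c}"
      by simp
    also have "?this \<longleftrightarrow> ((\<lambda>n. (if int m dvd int n - c then a n else 0) * q ^ n) has_sum 0) UNIV"
      by (rule has_sum_cong_neutral) auto
    finally show "(\<lambda>n. (if int m dvd int n - c then a n else 0) * q ^ n) sums 0"
      by (rule has_sum_imp_sums)
  qed
  with n show ?thesis by simp
qed

section \<open>The affine reflection\<close>

definition theta_exponent :: "nat \<Rightarrow> nat \<Rightarrow> int \<times> int \<times> int \<Rightarrow> int" where
  "theta_exponent r u = (\<lambda>(m, k, l). (int r * m + 7 * (m * (m - 1) div 2))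
     + ((int u * k + 21 * (k * (k - 1) div 2)) + (int u * l + 21 * (l * (l - 1) div 2))))"

definition theta_sign :: "complex \<Rightarrow> int \<times> int \<times> int \<Rightarrow> complex" where
  "theta_sign \<epsilon> = (\<lambda>(m, k, l). (-1) powi m * ((- \<epsilon>) powi k * (- \<epsilon>) powi l))"

text \<open>
  The mirror plane is \<open>2 (m + 3 \<sigma> (k + l)) + reflect_const \<sigma> d r = 0\<close>; it passes beside the
  origin because the exponent has a linear part.
\<close>

definition reflect_const :: "int \<Rightarrow> int \<Rightarrow> nat \<Rightarrow> int" where
  "reflect_const \<sigma> d r = 2 * int r + 4 * \<sigma> * d - 6 * \<sigma> - 1"

text \<open>
  The shift along \<open>(1, \<sigma>, \<sigma>)\<close> that preserves the exponent is the root \<open>t\<close> of the second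
  factor of \<open>7 t (7 t - \<dots>)\<close> in \<open>double_exponent_reflection\<close>. It is an integer only on one residue class of the
  exponent modulo \<open>7\<close>; elsewhere the rounding division gives a meaningless value.
\<close>

definition reflect_shift :: "int \<Rightarrow> int \<Rightarrow> nat \<Rightarrow> int \<times> int \<times> int \<Rightarrow> int" where
  "reflect_shift \<sigma> d r = (\<lambda>(m, k, l). (2 * (m + 3 * \<sigma> * (k + l)) + reflect_const \<sigma> d r) div 7)"

definition reflect :: "int \<Rightarrow> int \<Rightarrow> nat \<Rightarrow> int \<times> int \<times> int \<Rightarrow> int \<times> int \<times> int" where
  "reflect \<sigma> d r x = (case x of (m, k, l) \<Rightarrow>
     (m - reflect_shift \<sigma> d r x, k - \<sigma> * reflect_shift \<sigma> d r x, l - \<sigma> * reflect_shift \<sigma> d r x))"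

lemma double_theta_exponent:
  "2 * theta_exponent r u (m, k, l) =
     2 * int r * m + 7 * (m * (m - 1)) + 2 * int u * (k + l) + 21 * (k * (k - 1) + l * (l - 1))"
proof -
  have tri: "\<exists>t. j * (j - 1) = 2 * t" for j :: int
  proof -
    have "even (j * (j - 1))" by simp
    then show ?thesis by (rule evenE) (rule exI)
  qed
  obtain a b c where "m * (m - 1) = 2 * a" "k * (k - 1) = 2 * b" "l * (l - 1) = 2 * c"
    using tri by meson
  then show ?thesis by (simp add: theta_exponent_def distrib_left)
qed

text \<open>
  The substitution \<open>u = 3 \<sigma> r + 7 d\<close> is what allows a factor \<open>7\<close> to be taken out of the part
  that is linear in \<open>t\<close>; the part that is quadratic in \<open>t\<close> is \<open>(7 + 21 + 21) t\<^sup>2\<close>.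
\<close>

lemma double_exponent_reflection:
  fixes m k l t r d \<sigma> :: int
  assumes "\<sigma> \<in> {1, -1}" and "u = 3 * \<sigma> * r + 7 * d"
  shows "2 * r * (m - t) + 7 * ((m - t) * (m - t - 1)) + 2 * u * ((k - \<sigma> * t) + (l - \<sigma> * t))
      + 21 * ((k - \<sigma> * t) * (k - \<sigma> * t - 1) + (l - \<sigma> * t) * (l - \<sigma> * t - 1)) =
    2 * r * m + 7 * (m * (m - 1)) + 2 * u * (k + l) + 21 * (k * (k - 1) + l * (l - 1))
      + 7 * t * (7 * t - (2 * (m + 3 * \<sigma> * (k + l)) + (2 * r + 4 * \<sigma> * d - 6 * \<sigma> - 1)))"
proof -
  from assms(1) consider "\<sigma> = 1" | "\<sigma> = -1" by blast
  then show ?thesis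
  proof cases
    case 1
    show ?thesis unfolding assms(2) 1 by algebra
  next
    case 2
    show ?thesis unfolding assms(2) 2 by algebra
  qed
qed

text \<open>
  Modulo \<open>7\<close> the exponent is \<open>r y\<close> with \<open>y = m + 3 \<sigma> (k + l)\<close>, so its residue class \<open>c\<close>
  determines \<open>y\<close> modulo \<open>7\<close>; the condition on \<open>c\<close> says that this is the class of \<open>y\<close> for
  which the division in \<open>reflect_shift\<close> is exact.
\<close>

lemma reflect_shift_integral:
  assumes r: "coprime (int r) 7" and u: "int u = 3 * \<sigma> * int r + 7 * d"
    and c: "7 dvd 2 * c + int r * reflect_const \<sigma> d r"
    and e: "7 dvd theta_exponent r u (m, k, l) - c"
  shows "7 * reflect_shift \<sigma> d r (m, k, l) = 2 * (m + 3 * \<sigma> * (k + l)) + reflect_const \<sigma> d r"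
proof -
  define y where "y = m + 3 * \<sigma> * (k + l)"
  define w where "w = d * (k + l) + m * (m - 1) div 2 + 3 * (k * (k - 1) div 2) + 3 * (l * (l - 1) div 2)"
  have "theta_exponent r u (m, k, l) = int r * y + 7 * w"
    by (simp add: theta_exponent_def u y_def w_def ring_distribs)
  then have e': "7 dvd (int r * y - c) + 7 * w" using e by (simp add: algebra_simps)
  then have "7 dvd int r * y - c" by (simp add: dvd_add_left_iff)
  then have "7 dvd 2 * (int r * y - c) + (2 * c + int r * reflect_const \<sigma> d r)"
    by (intro dvd_add c dvd_mult)
  also have "\<dots> = int r * (2 * y + reflect_const \<sigma> d r)" by (simp add: algebra_simps)
  finally have "7 dvd 2 * y + reflect_const \<sigma> d r"
    using r by (simp add: coprime_dvd_mult_right_iff coprime_commute)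
  then show ?thesis by (simp add: reflect_shift_def y_def)
qed

lemma theta_exponent_reflect:
  assumes "\<sigma> \<in> {1, -1}" "int u = 3 * \<sigma> * int r + 7 * d"
    and "7 * reflect_shift \<sigma> d r (m, k, l) = 2 * (m + 3 * \<sigma> * (k + l)) + reflect_const \<sigma> d r"
  shows "theta_exponent r u (reflect \<sigma> d r (m, k, l)) = theta_exponent r u (m, k, l)"
proof -
  define t where "t = reflect_shift \<sigma> d r (m, k, l)"
  have t: "7 * t - (2 * (m + 3 * \<sigma> * (k + l)) + (2 * int r + 4 * \<sigma> * d - 6 * \<sigma> - 1)) = 0"
    using assms(3) by (simp add: t_def reflect_const_def)
  have "reflect \<sigma> d r (m, k, l) = (m - t, k - \<sigma> * t, l - \<sigma> * t)"
    by (simp add: reflect_def t_def)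
  then have "2 * theta_exponent r u (reflect \<sigma> d r (m, k, l)) = 2 * theta_exponent r u (m, k, l)"
    using double_exponent_reflection [OF assms(1,2), of m t k l]
    unfolding t by (simp only: double_theta_exponent)
  then show ?thesis by simp
qed

lemma reflect_shift_reflect:
  assumes "\<sigma> \<in> {1, -1}"
    and "7 * reflect_shift \<sigma> d r (m, k, l) = 2 * (m + 3 * \<sigma> * (k + l)) + reflect_const \<sigma> d r"
  shows "reflect_shift \<sigma> d r (reflect \<sigma> d r (m, k, l)) = - reflect_shift \<sigma> d r (m, k, l)"
proof -
  define t where "t = reflect_shift \<sigma> d r (m, k, l)"
  have "2 * ((m - t) + 3 * \<sigma> * ((k - \<sigma> * t) + (l - \<sigma> * t))) = 2 * (m + 3 * \<sigma> * (k + l)) - 14 * t"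
    using assms(1) by (auto simp: algebra_simps)
  then have "2 * ((m - t) + 3 * \<sigma> * ((k - \<sigma> * t) + (l - \<sigma> * t))) + reflect_const \<sigma> d r = 7 * (- t)"
    using assms(2) by (simp add: t_def)
  then have "reflect_shift \<sigma> d r (m - t, k - \<sigma> * t, l - \<sigma> * t) = - t"
    unfolding reflect_shift_def split by simp
  then show ?thesis by (simp add: reflect_def t_def)
qed

text \<open>
  The shift \<open>t\<close> is odd because \<open>reflect_const\<close> is. So \<open>m\<close> changes parity, and \<open>k\<close> and \<open>l\<close>
  change parity together, which leaves the power of \<open>-\<epsilon>\<close> unchanged.
\<close>

lemma theta_sign_reflect:
  assumes \<epsilon>: "\<epsilon> \<in> {1, -1}" and \<sigma>: "\<sigma> \<in> {1, -1}"
    and T: "7 * reflect_shift \<sigma> d r (m, k, l) = 2 * (m + 3 * \<sigma> * (k + l)) + reflect_const \<sigma> d r"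
  shows "theta_sign \<epsilon> (reflect \<sigma> d r (m, k, l)) = - theta_sign \<epsilon> (m, k, l)"
proof -
  define t where "t = reflect_shift \<sigma> d r (m, k, l)"
  have "odd (7 * t)" unfolding t_def T by (simp add: reflect_const_def)
  then have t: "odd t" by simp
  have "(-1 :: complex) powi (m - t) = - ((-1) powi m)"
    using t by (auto simp: power_int_minus_left)
  moreover have "(- \<epsilon>) powi (k - \<sigma> * t) * (- \<epsilon>) powi (l - \<sigma> * t) = (- \<epsilon>) powi k * (- \<epsilon>) powi l"
    using \<epsilon> \<sigma> t by (auto simp: power_int_minus_left)
  ultimately show ?thesis by (simp add: theta_sign_def reflect_def flip: t_def)
qed

section \<open>Vanishing of the coefficients\<close>

lemma theta_term_powi:
  fixes q :: complex
  assumes "q \<noteq> 0"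
  shows "theta_term (d * q ^ u) (q ^ v) k = (- d) powi k * q powi (int u * k + int v * (k * (k - 1) div 2))"
proof -
  have "- (d * q ^ u) = (- d) * q ^ u" by simp
  then show ?thesis
    using assms by (simp only: theta_term_def power_int_mult_distrib power_int_power mult.assoc)
      (simp add: power_int_add)
qed

lemma has_sum_theta_product:
  assumes q: "q \<noteq> 0" "norm q < 1" and \<epsilon>: "\<epsilon> \<in> {1, -1}" and r: "r \<le> 7" and u: "u \<le> 21"
  shows "((\<lambda>x. theta_sign \<epsilon> x * q powi theta_exponent r u x) has_sum
      qpoch_inf (q ^ 7) (q ^ 7) * (qpoch_inf (q ^ 21) (q ^ 21))\<^sup>2 *
      (qpochs_inf [q ^ r, q ^ (7 - r)] (q ^ 7) *
       (qpochs_inf [\<epsilon> * q ^ u, \<epsilon> * q ^ (21 - u)] (q ^ 21))\<^sup>2)) UNIV"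
proof -
  define F where "F = theta_term (1 * q ^ r) (q ^ 7)"
  define G where "G = theta_term (\<epsilon> * q ^ u) (q ^ 21)"
  define a where "a = qpochs_inf [q ^ r, q ^ (7 - r)] (q ^ 7)"
  define b where "b = qpochs_inf [\<epsilon> * q ^ u, \<epsilon> * q ^ (21 - u)] (q ^ 21)"
  define a' where "a' = qpoch_inf (q ^ 7) (q ^ 7)"
  define b' where "b' = qpoch_inf (q ^ 21) (q ^ 21)"
  have norm: "norm (q ^ 7) < 1" "norm (q ^ 21) < 1"
    using q by (simp_all add: norm_power power_less_one_iff)
  have "q ^ 7 / (1 * q ^ r) = q ^ (7 - r)" using r q by (simp add: power_diff)
  then have 1: "(F has_sum a * a') UNIV"
    using jacobi_triple_product [OF norm(1), of "1 * q ^ r"] q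
    by (simp add: F_def a_def a'_def qpochs_inf_def)
  have \<epsilon>0: "\<epsilon> * q ^ u \<noteq> 0" using \<epsilon> q by auto
  have "q ^ 21 / (\<epsilon> * q ^ u) = \<epsilon> * q ^ (21 - u)" using \<epsilon> u q by (auto simp: power_diff)
  then have 2: "(G has_sum b * b') UNIV"
    using jacobi_triple_product [OF norm(2) _ \<epsilon>0] q
    by (simp add: G_def b_def b'_def qpochs_inf_def)
  have "((\<lambda>(m, y). F m * (case y of (k, l) \<Rightarrow> G k * G l)) has_sum a * a' * (b * b' * (b * b')))
      (UNIV \<times> (UNIV \<times> UNIV))"
    by (rule has_sum_times [OF 1 has_sum_times [OF 2 2]])
  also have "a * a' * (b * b' * (b * b')) = a' * b'\<^sup>2 * (a * b\<^sup>2)"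
    by (simp add: power2_eq_square mult_ac)
  also have "(\<lambda>(m, y). F m * (case y of (k, l) \<Rightarrow> G k * G l)) =
      (\<lambda>x. theta_sign \<epsilon> x * q powi theta_exponent r u x)"
  proof (rule ext)
    fix x :: "int \<times> int \<times> int"
    obtain m k l where x: "x = (m, k, l)" by (cases x)
    have add: "q powi (i + j) = q powi i * q powi j" for i j using q by (simp add: power_int_add)
    show "(case x of (m, y) \<Rightarrow> F m * (case y of (k, l) \<Rightarrow> G k * G l)) =
        theta_sign \<epsilon> x * q powi theta_exponent r u x"
      unfolding x split F_def G_def theta_term_powi [OF q(1)] theta_sign_def theta_exponent_def add
      by simp
  qed
  finally show ?thesis unfolding a_def b_def a'_def b'_def by simp
qed

lemma theta_section_eq_0:
  assumes q: "q \<noteq> 0" "norm q < 1" and \<epsilon>: "\<epsilon> \<in> {1, -1}" and r: "0 < r" "r < 7" and u: "u \<le> 21"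
    and \<sigma>: "\<sigma> \<in> {1, -1}" and ru: "int u = 3 * \<sigma> * int r + 7 * d"
    and c: "7 dvd 2 * c + int r * reflect_const \<sigma> d r"
  shows "((\<lambda>x. theta_sign \<epsilon> x * q powi theta_exponent r u x) has_sum 0)
     {x. 7 dvd theta_exponent r u x - c}" (is "(?f has_sum 0) ?B")
proof (rule has_sum_0_sign_reversing [where \<rho> = "reflect \<sigma> d r"])
  have "r \<in> {1,2,3,4,5,6}" using r by auto
  then have "coprime (int r) 7" by (elim insertE) (simp_all add: coprime_iff_gcd_eq_1 gcd_non_0_int)
  note shift = reflect_shift_integral [OF this ru c]
  have exponent: "theta_exponent r u (reflect \<sigma> d r x) = theta_exponent r u x" if "x \<in> ?B" for x
    using theta_exponent_reflect [OF \<sigma> ru shift] that by (cases x) auto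
  show "?f summable_on ?B"
    by (rule summable_on_subset_banach [of _ UNIV])
       (use has_sum_theta_product [OF q \<epsilon>, of r u] r u in \<open>auto simp: summable_on_def\<close>)
  fix x assume x: "x \<in> ?B"
  obtain m k l where mkl: "x = (m, k, l)" by (cases x)
  have T: "7 * reflect_shift \<sigma> d r (m, k, l) = 2 * (m + 3 * \<sigma> * (k + l)) + reflect_const \<sigma> d r"
    using shift x mkl by simp
  show "reflect \<sigma> d r x \<in> ?B" using exponent [OF x] x by simp
  have "reflect_shift \<sigma> d r (reflect \<sigma> d r x) = - reflect_shift \<sigma> d r x"
    unfolding mkl by (rule reflect_shift_reflect [OF \<sigma> T])
  then show "reflect \<sigma> d r (reflect \<sigma> d r x) = x"
    unfolding mkl by (simp add: reflect_def)
  show "?f (reflect \<sigma> d r x) = - ?f x"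
    using theta_sign_reflect [OF \<epsilon> \<sigma> T] exponent [OF x] unfolding mkl by simp
qed

text \<open>
  The cancellation for a general pair \<open>(r, u)\<close>: for every \<open>u\<close> congruent to \<open>\<plusminus>3 r\<close> modulo \<open>7\<close>
  there is one residue class \<open>c\<close> of vanishing coefficients.
\<close>

theorem theta_product_coeff_eq_0:
  fixes \<epsilon> :: complex and a :: "nat \<Rightarrow> complex" and r u n :: nat and \<sigma> d c :: int
  assumes a: "\<And>q. norm q < 1 \<Longrightarrow> (\<lambda>n. a n * q ^ n) sums
        (qpochs_inf [q ^ r, q ^ (7 - r)] (q ^ 7) * (qpochs_inf [\<epsilon> * q ^ u, \<epsilon> * q ^ (21 - u)] (q ^ 21))\<^sup>2)"
    and \<epsilon>: "\<epsilon> \<in> {1, -1}"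
    and r: "0 < r" "r < 7" and u: "u \<le> 21" and \<sigma>: "\<sigma> \<in> {1, -1}"
    and ru: "int u = 3 * \<sigma> * int r + 7 * d"
    and c: "7 dvd 2 * c + int r * reflect_const \<sigma> d r"
    and n: "7 dvd int n - c"
  shows "a n = 0"
proof (rule coeffs_residue_class_eq_0 [where m = 7 and A = UNIV, OF _ a])
  fix q :: complex assume q: "q \<noteq> 0" "norm q < 1"
  have "q ^ 21 = (q ^ 7) ^ 3" by (simp flip: power_mult)
  then show "((\<lambda>x. theta_sign \<epsilon> x * q powi theta_exponent r u x) has_sum
      (\<lambda>y. qpoch_inf y y * (qpoch_inf (y ^ 3) (y ^ 3))\<^sup>2) (q ^ 7) *
      (qpochs_inf [q ^ r, q ^ (7 - r)] (q ^ 7) *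
       (qpochs_inf [\<epsilon> * q ^ u, \<epsilon> * q ^ (21 - u)] (q ^ 21))\<^sup>2)) UNIV"
    using has_sum_theta_product [OF q \<epsilon>, of r u] r u by simp
  show "((\<lambda>x. theta_sign \<epsilon> x * q powi theta_exponent r u x) has_sum 0)
      {x \<in> UNIV. int 7 dvd theta_exponent r u x - c}"
    using theta_section_eq_0 [OF q \<epsilon> r u \<sigma> ru c] by simp
next
  fix y :: complex assume y: "norm y < 1"
  then have "norm (y ^ 3) < 1" by (simp add: norm_power power_less_one_iff)
  with y show "qpoch_inf y y * (qpoch_inf (y ^ 3) (y ^ 3))\<^sup>2 \<noteq> 0"
    by (simp add: qpoch_inf_self_neq_0)
qed (use n in auto)

theorem theorem3p4:
  fixes \<epsilon> :: complex and h i j :: "nat \<Rightarrow> nat \<Rightarrow> complex"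
  assumes "\<epsilon> \<in> {1, -1}"
    and "\<And>u q. u \<le> 15 \<Longrightarrow> norm q < 1 \<Longrightarrow>
      (\<lambda>n. h u n * q ^ n) sums
        (qpochs_inf [q, q ^ 6] (q ^ 7) * (qpochs_inf [\<epsilon> * q ^ u, \<epsilon> * q ^ (21 - u)] (q ^ 21))\<^sup>2)"
    and "\<And>v q. v \<le> 15 \<Longrightarrow> norm q < 1 \<Longrightarrow>
      (\<lambda>n. i v n * q ^ n) sums
        (qpochs_inf [q ^ 2, q ^ 5] (q ^ 7) * (qpochs_inf [\<epsilon> * q ^ v, \<epsilon> * q ^ (21 - v)] (q ^ 21))\<^sup>2)"
    and "\<And>w q. w \<le> 15 \<Longrightarrow> norm q < 1 \<Longrightarrow>
      (\<lambda>n. j w n * q ^ n) sums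
        (qpochs_inf [q ^ 3, q ^ 4] (q ^ 7) * (qpochs_inf [\<epsilon> * q ^ w, \<epsilon> * q ^ (21 - w)] (q ^ 21))\<^sup>2)"
  shows "\<forall>n. h 3 (7 * n + 6) = 0 \<and> h 4 (7 * n + 2) = 0 \<and> h 10 (7 * n + 4) = 0 \<and>
             i 1 (7 * n + 2) = 0 \<and> i 6 (7 * n + 3) = 0 \<and> i 8 (7 * n + 6) = 0 \<and>
             j 2 (7 * n + 4) = 0 \<and> j 5 (7 * n + 6) = 0 \<and> j 9 (7 * n + 5) = 0"
proof -
  have h: "u \<le> 15 \<Longrightarrow> norm q < 1 \<Longrightarrow> (\<lambda>n. h u n * q ^ n) sums
      (qpochs_inf [q ^ 1, q ^ (7 - 1)] (q ^ 7) * (qpochs_inf [\<epsilon> * q ^ u, \<epsilon> * q ^ (21 - u)] (q ^ 21))\<^sup>2)" for u q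
    using assms(2) [of u q] by simp
  have i: "u \<le> 15 \<Longrightarrow> norm q < 1 \<Longrightarrow> (\<lambda>n. i u n * q ^ n) sums
      (qpochs_inf [q ^ 2, q ^ (7 - 2)] (q ^ 7) * (qpochs_inf [\<epsilon> * q ^ u, \<epsilon> * q ^ (21 - u)] (q ^ 21))\<^sup>2)" for u q
    using assms(3) [of u q] by simp
  have j: "u \<le> 15 \<Longrightarrow> norm q < 1 \<Longrightarrow> (\<lambda>n. j u n * q ^ n) sums
      (qpochs_inf [q ^ 3, q ^ (7 - 3)] (q ^ 7) * (qpochs_inf [\<epsilon> * q ^ u, \<epsilon> * q ^ (21 - u)] (q ^ 21))\<^sup>2)" for u q
    using assms(4) [of u q] by simp
  note vanish = theta_product_coeff_eq_0
  show ?thesis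
  proof (intro allI conjI)
    fix n
    \<comment> \<open>\<open>\<sigma>\<close> is the sign for which \<open>u \<equiv> 3 \<sigma> r\<close> modulo \<open>7\<close>, and
      \<open>d = (u - 3 \<sigma> r) / 7\<close>.\<close>
    show "h 3 (7 * n + 6) = 0"
      by (rule vanish [OF h [of 3] assms(1), where \<sigma> = 1 and d = 0 and c = 6]) (simp_all add: reflect_const_def)
    show "h 4 (7 * n + 2) = 0"
      by (rule vanish [OF h [of 4] assms(1), where \<sigma> = "-1" and d = 1 and c = 2]) (simp_all add: reflect_const_def)
    show "h 10 (7 * n + 4) = 0"
      by (rule vanish [OF h [of 10] assms(1), where \<sigma> = 1 and d = 1 and c = 4]) (simp_all add: reflect_const_def)
    show "i 1 (7 * n + 2) = 0"
      by (rule vanish [OF i [of 1] assms(1), where \<sigma> = "-1" and d = 1 and c = 2]) (simp_all add: reflect_const_def)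
    show "i 6 (7 * n + 3) = 0"
      by (rule vanish [OF i [of 6] assms(1), where \<sigma> = 1 and d = 0 and c = 3]) (simp_all add: reflect_const_def)
    show "i 8 (7 * n + 6) = 0"
      by (rule vanish [OF i [of 8] assms(1), where \<sigma> = "-1" and d = 2 and c = 6]) (simp_all add: reflect_const_def)
    show "j 2 (7 * n + 4) = 0"
      by (rule vanish [OF j [of 2] assms(1), where \<sigma> = 1 and d = "-1" and c = 4]) (simp_all add: reflect_const_def)
    show "j 5 (7 * n + 6) = 0"
      by (rule vanish [OF j [of 5] assms(1), where \<sigma> = "-1" and d = 2 and c = 6]) (simp_all add: reflect_const_def)
    show "j 9 (7 * n + 5) = 0"
      by (rule vanish [OF j [of 9] assms(1), where \<sigma> = 1 and d = 0 and c = 5]) (simp_all add: reflect_const_def)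
  qed
qed

end
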